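(* Let $n\ge 1$ be an integer, let $f,h\in C^{n}[a,b]$ be (complex valued) functions with $f(x)\neq 0$ for $x\in[a,b]$, and put $\varphi=f^{2}$. Let $\gamma_0(h),\ldots,\gamma_n(h)$ be the generalized derivatives of $h$ with respect to $f$ defined in the context. Then at every point $x_{0}\in[a,b]$ the following relation between the ordinary derivatives and the generalized derivatives of $h$ is valid: $$\begin{pmatrix} h(x_{0})\\ h'(x_{0})\\ h''(x_{0})\\ h'''(x_{0})\\ \vdots\\ h^{[n]}(x_{0})\end{pmatrix}=\begin{pmatrix} 1&0&0&0&\cdots&0\\ 0&1/\varphi(x_{0})&0&0&\cdots&0\\ 0&a_{2,1}(x_{0})&1&0&\cdots&0\\ 0&a_{3,1}(x_{0})&a_{3,2}(x_{0})&1/\varphi(x_{0})&\cdots&0\\ \vdots&\vdots&\vdots&\vdots&\ddots&\vdots\\ 0&a_{n,1}(x_{0})&a_{n,2}(x_{0})&a_{n,3}(x_{0})&\cdots&\varphi^{-\frac{1+(-1)^{n+1}}{2}}(x_{0}) \end{pmatrix}\begin{pmatrix}\gamma_{0}(h)(x_{0})\\ \gamma_{1}(h)(x_{0})\\ \gamma_{2}(h)(x_{0})\\ \gamma_{3}(h)(x_{0})\\ \vdots\\ \gamma_{n}(h)(x_{0})\end{pmatrix},$$ where the matrix is lower triangular with rows and columns indexed by $0,1,\ldots,n$, its $(j,j)$ diagonal entry is $\varphi^{-\frac{1+(-1)^{j+1}}{2}}(x_0)$ for $1\le j\le n$ (that is, $1/\varphi(x_0)$ for odd $j$ and $1$ for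 even $j$), and the functions $a_{j,m}$ are calculated by the recursive procedure $$a_{j,m}=a_{j-1,m}'+\varphi^{(-1)^{m}}a_{j-1,m-1}.$$
   Context: $h^{[k]}$ denotes the ordinary $k$-th derivative of $h$; derivatives at end points of $[a,b]$ are one-sided. The generalized derivatives with respect to $f$ are $\gamma_{0}(h)=h$ and, for $k=1,\ldots,n$, $$\gamma_{k}(h)(x)=\left(f^{2}(x)\right)^{(-1)^{k-1}}\big(\gamma_{k-1}(h)\big)'(x).$$ In the recursion, $1\le m\le j\le n$, $a_{j,m}$ is the function whose value at $x_0$ is the $(j,m)$ entry of the matrix, with starting values read off from the matrix: $a_{0,0}=1$, $a_{j,0}=0$ for $j\geq 1$, and $a_{j,m}=0$ for $m>j$ (so in particular $a_{1,1}=1/\varphi$). *)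

theory Defs
  imports "HOL-Analysis.Derivative" "Jordan_Normal_Form.Matrix"
begin

text \<open>
  Derivatives are taken within \<open>{a..b}\<close>, hence one-sided at the end points. Only values on
  \<open>{a..b}\<close> are meaningful, and only for functions differentiable there.
\<close>

definition deriv_on :: "real \<Rightarrow> real \<Rightarrow> (real \<Rightarrow> complex) \<Rightarrow> real \<Rightarrow> complex" where
  "deriv_on a b g = (\<lambda>x. vector_derivative g (at x within {a..b}))"

definition nth_deriv_on :: "real \<Rightarrow> real \<Rightarrow> nat \<Rightarrow> (real \<Rightarrow> complex) \<Rightarrow> real \<Rightarrow> complex" where
  "nth_deriv_on a b k g = (deriv_on a b ^^ k) g"

definition C_n_on :: "nat \<Rightarrow> real \<Rightarrow> real \<Rightarrow> (real \<Rightarrow> complex) \<Rightarrow> bool" where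
  "C_n_on n a b g \<longleftrightarrow>
     (\<forall>k<n. nth_deriv_on a b k g differentiable_on {a..b}) \<and>
     (\<forall>k\<le>n. continuous_on {a..b} (nth_deriv_on a b k g))"

fun gen_deriv ::
  "real \<Rightarrow> real \<Rightarrow> (real \<Rightarrow> complex) \<Rightarrow> nat \<Rightarrow> (real \<Rightarrow> complex) \<Rightarrow> real \<Rightarrow> complex" where
  "gen_deriv a b f 0 h = h"
| "gen_deriv a b f (Suc k) h =
     (\<lambda>x. ((f x)\<^sup>2) powi ((- 1) ^ k) * deriv_on a b (gen_deriv a b f k h) x)"

fun coeff_fun :: "real \<Rightarrow> real \<Rightarrow> (real \<Rightarrow> complex) \<Rightarrow> nat \<Rightarrow> nat \<Rightarrow> real \<Rightarrow> complex" where
  "coeff_fun a b \<phi> j 0 = (\<lambda>x. if j = 0 then 1 else 0)"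
| "coeff_fun a b \<phi> 0 (Suc m) = (\<lambda>x. 0)"
| "coeff_fun a b \<phi> (Suc j) (Suc m) =
     (if m \<le> j
      then (\<lambda>x. deriv_on a b (coeff_fun a b \<phi> j (Suc m)) x
                + \<phi> x powi ((- 1) ^ Suc m) * coeff_fun a b \<phi> j m x)
      else (\<lambda>x. 0))"

text \<open>
  The diagonal is written in closed form, independently of the recursion; the exponent is an
  integer, so the division is exact. For \<open>j = m = 0\<close> it gives the corner entry 1, and below the
  corner the first column is \<open>coeff_fun a b \<phi> j 0 = (\<lambda>x. 0)\<close>.
\<close>

definition transition_mat ::
  "real \<Rightarrow> real \<Rightarrow> (real \<Rightarrow> complex) \<Rightarrow> nat \<Rightarrow> real \<Rightarrow> complex mat" where
  "transition_mat a b \<phi> n x = mat (n + 1) (n + 1) (\<lambda>(j, m).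
     if j < m then 0
     else if j = m then \<phi> x powi (- ((1 + (- 1) ^ (j + 1)) div 2))
     else coeff_fun a b \<phi> j m x)"

end

theory Submission
  imports Defs
begin

text \<open>
  Write \<open>\<gamma>\<^sub>m\<close> for the generalized derivatives of \<open>h\<close> and \<open>a\<^sub>j\<^sub>,\<^sub>m\<close> for the coefficient functions.
  Since \<open>\<gamma>\<^sub>m\<^sub>+\<^sub>1 = \<phi>\<^bsup>(-1)^m\<^esup> \<gamma>\<^sub>m'\<close> and \<open>\<phi>\<close> has no zero, the definition can be solved for the
  ordinary derivative, \<open>\<gamma>\<^sub>m' = \<phi>\<^bsup>(-1)^(m+1)\<^esup> \<gamma>\<^sub>m\<^sub>+\<^sub>1\<close>. Differentiating
  \<open>h\<^bsup>[j]\<^esup> = \<Sum>m\<le>j. a\<^sub>j\<^sub>,\<^sub>m \<gamma>\<^sub>m\<close> by the product rule therefore gives again a combination of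
  generalized derivatives, in which \<open>\<gamma>\<^sub>m\<close> has the coefficient
  \<open>a\<^sub>j\<^sub>,\<^sub>m' + \<phi>\<^bsup>(-1)^m\<^esup> a\<^sub>j\<^sub>,\<^sub>m\<^sub>-\<^sub>1\<close>. This is the recursion, so the relation follows by
  induction on \<open>j\<close> (\<open>nth_deriv_on_eq_sum_coeff_fun\<close>). On the diagonal \<open>a\<^sub>j\<^sub>-\<^sub>1\<^sub>,\<^sub>j\<close> vanishes and
  \<open>a\<^sub>j\<^sub>,\<^sub>j = \<phi>\<^bsup>(-1)^j\<^esup> a\<^sub>j\<^sub>-\<^sub>1\<^sub>,\<^sub>j\<^sub>-\<^sub>1\<close>, which alternates between \<open>1\<close> and \<open>1/\<phi>\<close>
  (\<open>coeff_fun_diagonal\<close>).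

  The product rule may be applied only to differentiable functions. That nothing is differentiated
  too often is a matter of counting: functions of class \<open>C\<^sup>k\<close> on the interval are closed under
  sums, products and reciprocals of zero-free functions, and each step of either recursion costs
  one derivative, so that \<open>\<gamma>\<^sub>k\<close> and \<open>a\<^sub>k\<^sub>,\<^sub>m\<close> are of class \<open>C\<^bsup>n-k\<^esup>\<close> (\<open>C_n_on_gen_deriv\<close>,
  \<open>C_n_on_coeff_fun\<close>).
\<close>

section \<open>Derivatives within a closed interval\<close>

lemma has_vector_derivative_deriv_on:
  assumes "g differentiable_on {a..b}" "x \<in> {a..b}"
  shows "(g has_vector_derivative deriv_on a b g x) (at x within {a..b})"
  using assms by (simp add: deriv_on_def differentiable_on_def vector_derivative_works)

lemma deriv_on_unique:
  assumes "a < b" "x \<in> {a..b}" "(g has_vector_derivative d) (at x within {a..b})"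
  shows "deriv_on a b g x = d"
  using assms by (auto simp: deriv_on_def intro!: vector_derivative_within_closed_interval)

lemma differentiable_onI_vector:
  assumes "\<And>x. x \<in> S \<Longrightarrow> (g has_vector_derivative d x) (at x within S)"
  shows "g differentiable_on S"
  using assms by (auto simp: differentiable_on_def intro: differentiableI_vector)

lemma has_vector_derivative_within_cong:
  assumes "\<And>x. x \<in> S \<Longrightarrow> g x = g' x" "x \<in> S"
  shows "(g has_vector_derivative d) (at x within S)
    \<longleftrightarrow> (g' has_vector_derivative d) (at x within S)"
  using assms has_vector_derivative_transform[of x S] by metis

lemma deriv_on_cong:
  assumes "\<And>x. x \<in> {a..b} \<Longrightarrow> g x = g' x" "x \<in> {a..b}"
  shows "deriv_on a b g x = deriv_on a b g' x"
  unfolding deriv_on_def vector_derivative_def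
  using has_vector_derivative_within_cong[OF assms] by simp

lemma deriv_on_const:
  assumes "a < b" "x \<in> {a..b}"
  shows "deriv_on a b (\<lambda>x. c) x = 0"
  using assms by (intro deriv_on_unique) auto

lemma nth_deriv_on_0 [simp]: "nth_deriv_on a b 0 g = g"
  by (simp add: nth_deriv_on_def)

lemma nth_deriv_on_Suc: "nth_deriv_on a b (Suc k) g = deriv_on a b (nth_deriv_on a b k g)"
  by (simp add: nth_deriv_on_def)

lemma nth_deriv_on_Suc_shift:
  "nth_deriv_on a b (Suc k) g = nth_deriv_on a b k (deriv_on a b g)"
  by (simp add: nth_deriv_on_def funpow_swap1)

section \<open>Closure properties of functions of class \<open>C\<^sup>n\<close>\<close>

lemma C_n_on_0: "C_n_on 0 a b g \<longleftrightarrow> continuous_on {a..b} g"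
  by (simp add: C_n_on_def)

text \<open>
  Peeling off the innermost derivative turns every closure property below into an induction on
  the order that applies one differentiation rule.
\<close>

lemma C_n_on_Suc:
  "C_n_on (Suc n) a b g \<longleftrightarrow> g differentiable_on {a..b} \<and> C_n_on n a b (deriv_on a b g)"
proof -
  have "(\<forall>k\<le>Suc n. P k) \<longleftrightarrow> P 0 \<and> (\<forall>k\<le>n. P (Suc k))" for P
    by (metis Suc_le_mono le0 not0_implies_Suc)
  then show ?thesis
    unfolding C_n_on_def All_less_Suc2 nth_deriv_on_Suc_shift[symmetric]
    using differentiable_imp_continuous_on[of g "{a..b}"] by auto
qed

lemma C_n_on_mono:
  assumes "C_n_on n a b g" "k \<le> n"
  shows "C_n_on k a b g"
  using assms by (auto simp: C_n_on_def)

lemma C_n_on_SucD: "C_n_on (Suc n) a b g \<Longrightarrow> C_n_on n a b g"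
  by (rule C_n_on_mono) auto

lemma C_n_on_cong:
  assumes "\<And>x. x \<in> {a..b} \<Longrightarrow> g x = g' x" "C_n_on n a b g"
  shows "C_n_on n a b g'"
  using assms
proof (induction n arbitrary: g g')
  case 0
  then show ?case using continuous_on_cong[OF refl, of "{a..b}" g g'] by (simp add: C_n_on_0)
next
  case (Suc n)
  have "g' differentiable_on {a..b}"
  proof (rule differentiable_onI_vector)
    fix x assume "x \<in> {a..b}"
    with Suc.prems show "(g' has_vector_derivative deriv_on a b g x) (at x within {a..b})"
      using has_vector_derivative_within_cong[of "{a..b}" g g' x]
        has_vector_derivative_deriv_on[of g a b x]
      by (simp add: C_n_on_Suc)
  qed
  moreover have "C_n_on n a b (deriv_on a b g')"
  proof (rule Suc.IH)
    show "deriv_on a b g x = deriv_on a b g' x" if "x \<in> {a..b}" for x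
      using Suc.prems(1) that by (rule deriv_on_cong)
    show "C_n_on n a b (deriv_on a b g)"
      using Suc.prems(2) by (simp add: C_n_on_Suc)
  qed
  ultimately show ?case by (simp add: C_n_on_Suc)
qed

text \<open>
  The differentiation rules supply a derivative \<open>d\<close> as an explicit term, on the interval only, so
  it has to be exchanged for \<open>deriv_on a b g\<close> there.
\<close>

lemma C_n_on_SucI:
  assumes "a < b" "C_n_on n a b d"
    and "\<And>x. x \<in> {a..b} \<Longrightarrow> (g has_vector_derivative d x) (at x within {a..b})"
  shows "C_n_on (Suc n) a b g"
  unfolding C_n_on_Suc
proof
  show "g differentiable_on {a..b}"
    using assms(3) by (rule differentiable_onI_vector)
  show "C_n_on n a b (deriv_on a b g)"
  proof (rule C_n_on_cong)
    show "d x = deriv_on a b g x" if "x \<in> {a..b}" for x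
      using deriv_on_unique[OF assms(1) that assms(3)[OF that]] by simp
  qed (rule assms(2))
qed

lemma C_n_on_const:
  assumes "a < b"
  shows "C_n_on n a b (\<lambda>x. c)"
proof (induction n arbitrary: c)
  case (Suc n)
  then show ?case
    using assms by (intro C_n_on_SucI[where d = "\<lambda>x. 0"]) auto
qed (simp add: C_n_on_0)

lemma C_n_on_add:
  assumes "a < b" "C_n_on n a b g" "C_n_on n a b g'"
  shows "C_n_on n a b (\<lambda>x. g x + g' x)"
  using assms(2,3)
proof (induction n arbitrary: g g')
  case 0
  then show ?case by (auto simp: C_n_on_0 intro: continuous_intros)
next
  case (Suc n)
  then show ?case
    using \<open>a < b\<close>
    by (intro C_n_on_SucI[where d = "\<lambda>x. deriv_on a b g x + deriv_on a b g' x"]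
        has_vector_derivative_add has_vector_derivative_deriv_on Suc.IH) (auto simp: C_n_on_Suc)
qed

lemma C_n_on_mult:
  assumes "a < b" "C_n_on n a b g" "C_n_on n a b g'"
  shows "C_n_on n a b (\<lambda>x. g x * g' x)"
  using assms(2,3)
proof (induction n arbitrary: g g')
  case 0
  then show ?case by (auto simp: C_n_on_0 intro: continuous_intros)
next
  case (Suc n)
  from Suc.prems have "C_n_on n a b g" "C_n_on n a b g'"
    by (simp_all add: C_n_on_SucD)
  with Suc show ?case
    using \<open>a < b\<close>
    by (intro C_n_on_SucI[where d = "\<lambda>x. g x * deriv_on a b g' x + deriv_on a b g x * g' x"]
        has_vector_derivative_mult has_vector_derivative_deriv_on C_n_on_add) (auto simp: C_n_on_Suc)
qed

lemma C_n_on_inverse: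
  assumes "a < b" "C_n_on n a b g" "\<And>x. x \<in> {a..b} \<Longrightarrow> g x \<noteq> 0"
  shows "C_n_on n a b (\<lambda>x. inverse (g x))"
  using assms(2)
proof (induction n)
  case 0
  then show ?case using assms(3) by (auto simp: C_n_on_0 intro: continuous_intros)
next
  case (Suc n)
  let ?i = "\<lambda>x. inverse (g x)"
  have i: "C_n_on n a b ?i"
    using Suc by (simp add: C_n_on_SucD)
  have "(?i has_vector_derivative (- 1) * (deriv_on a b g x * (?i x * ?i x))) (at x within {a..b})"
    if "x \<in> {a..b}" for x
  proof -
    have "((inverse \<circ> g) has_vector_derivative
        deriv_on a b g x * - (inverse (g x) ^ Suc (Suc 0))) (at x within {a..b})"
      using Suc.prems assms(3) that
      by (intro field_vector_diff_chain_within has_vector_derivative_deriv_on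
            DERIV_inverse[THEN has_field_derivative_at_within])
         (auto simp: C_n_on_Suc)
    then show ?thesis by (simp add: o_def)
  qed
  moreover have "C_n_on n a b (\<lambda>x. (- 1) * (deriv_on a b g x * (?i x * ?i x)))"
    using Suc.prems i \<open>a < b\<close>
    by (intro C_n_on_mult C_n_on_const) (auto simp: C_n_on_Suc)
  ultimately show ?case
    using \<open>a < b\<close> by (intro C_n_on_SucI)
qed

text \<open>The only integer powers of \<open>\<phi>\<close> in either recursion are \<open>\<phi>\<close> and \<open>1/\<phi>\<close>.\<close>

lemma C_n_on_powi_sign:
  assumes "a < b" "C_n_on n a b g" "\<And>x. x \<in> {a..b} \<Longrightarrow> g x \<noteq> 0"
  shows "C_n_on n a b (\<lambda>x. g x powi ((- 1) ^ k))"
  using assms C_n_on_inverse[OF assms]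
  by (cases "even k") (simp_all add: power_int_minus)

section \<open>Regularity of the generalized derivatives and of the coefficients\<close>

text \<open>
  The lemmas are stated for a class \<open>C\<^sup>i\<close> of the result and a class \<open>C\<^bsup>i+k\<^esup>\<close> of the data, which
  keeps truncated subtraction out of the inductions.
\<close>

lemma C_n_on_gen_deriv:
  assumes "a < b" "C_n_on (i + k) a b f" "C_n_on (i + k) a b h"
    and "\<And>x. x \<in> {a..b} \<Longrightarrow> f x \<noteq> 0"
  shows "C_n_on i a b (gen_deriv a b f k h)"
  using assms(2,3)
proof (induction k arbitrary: i)
  case (Suc k)
  then have "C_n_on (Suc i) a b (gen_deriv a b f k h)" by simp
  moreover have "C_n_on i a b f"
    using Suc.prems(1) by (rule C_n_on_mono) simp
  then have "C_n_on i a b (\<lambda>x. (f x)\<^sup>2 powi ((- 1) ^ k))"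
    unfolding power2_eq_square
    using assms(1,4) by (intro C_n_on_powi_sign C_n_on_mult) auto
  ultimately show ?case
    using \<open>a < b\<close> by (auto simp: C_n_on_Suc intro: C_n_on_mult)
qed simp

lemma C_n_on_coeff_fun:
  assumes "a < b" "C_n_on (i + j) a b \<phi>" "\<And>x. x \<in> {a..b} \<Longrightarrow> \<phi> x \<noteq> 0"
  shows "C_n_on i a b (coeff_fun a b \<phi> j m)"
  using assms(2)
proof (induction j arbitrary: i m)
  case 0
  then show ?case using \<open>a < b\<close> by (cases m) (auto intro: C_n_on_const)
next
  case (Suc j)
  show ?case
  proof (cases m)
    case 0
    then show ?thesis using \<open>a < b\<close> by (auto intro: C_n_on_const)
  next
    case (Suc l)
    have c: "C_n_on (Suc i) a b (coeff_fun a b \<phi> j p)" for p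
      using Suc.IH Suc.prems by simp
    have "C_n_on i a b \<phi>"
      using Suc.prems by (rule C_n_on_mono) simp
    then have "C_n_on i a b (\<lambda>x. \<phi> x powi ((- 1) ^ Suc l))"
      using assms(1,3) by (intro C_n_on_powi_sign)
    with c[of l, THEN C_n_on_SucD] c[of "Suc l"]
    have "C_n_on i a b (\<lambda>x. deriv_on a b (coeff_fun a b \<phi> j (Suc l)) x
        + \<phi> x powi ((- 1) ^ Suc l) * coeff_fun a b \<phi> j l x)"
      using \<open>a < b\<close> by (intro C_n_on_add C_n_on_mult) (auto simp: C_n_on_Suc)
    then show ?thesis
      using \<open>a < b\<close> Suc by (auto intro: C_n_on_const)
  qed
qed

section \<open>The recursion in full and the diagonal entries\<close>

lemma coeff_fun_above_diagonal: "j < m \<Longrightarrow> coeff_fun a b \<phi> j m = (\<lambda>x. 0)"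
  by (cases m; cases j) auto

text \<open>
  In column \<open>0\<close> the recursion holds without its second term; the induction for the main relation
  can then treat all columns by one product rule.
\<close>

lemma coeff_fun_Suc_0:
  assumes "a < b" "x \<in> {a..b}"
  shows "coeff_fun a b \<phi> (Suc j) 0 x = deriv_on a b (coeff_fun a b \<phi> j 0) x"
  using assms by (simp add: deriv_on_const)

lemma coeff_fun_diagonal:
  assumes "a < b" "x \<in> {a..b}" "\<phi> x \<noteq> 0"
  shows "coeff_fun a b \<phi> j j x = \<phi> x powi (- ((1 + (- 1) ^ (j + 1)) div 2))"
proof (induction j)
  case (Suc j)
  have "coeff_fun a b \<phi> (Suc j) (Suc j) x = \<phi> x powi ((- 1) ^ Suc j) * coeff_fun a b \<phi> j j x"
    using assms by (simp add: coeff_fun_above_diagonal deriv_on_const)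
  with Suc.IH show ?case
    using assms(3) by (cases "even j") (simp_all add: power_int_minus)
qed simp

section \<open>Ordinary derivatives as combinations of generalized derivatives\<close>

lemma deriv_on_gen_deriv:
  assumes "f x \<noteq> 0"
  shows "deriv_on a b (gen_deriv a b f m h) x
    = (f x)\<^sup>2 powi ((- 1) ^ Suc m) * gen_deriv a b f (Suc m) h x"
  using assms by (cases "even m") (simp_all add: power_int_minus)

lemma nth_deriv_on_eq_sum_coeff_fun:
  fixes f h :: "real \<Rightarrow> complex"
  defines "\<phi> \<equiv> \<lambda>x. (f x)\<^sup>2"
  assumes "a < b" "C_n_on n a b f" "C_n_on n a b h"
    and nz: "\<And>x. x \<in> {a..b} \<Longrightarrow> f x \<noteq> 0"
    and "j \<le> n" "x \<in> {a..b}"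
  shows "nth_deriv_on a b j h x
    = (\<Sum>m\<le>j. coeff_fun a b \<phi> j m x * gen_deriv a b f m h x)"
  using assms(6,7)
proof (induction j arbitrary: x)
  case (Suc j)
  let ?c = "\<lambda>m. coeff_fun a b \<phi> j m" and ?g = "\<lambda>m. gen_deriv a b f m h"
  let ?D = "deriv_on a b"
  have "C_n_on n a b \<phi>"
    unfolding \<phi>_def power2_eq_square using assms by (intro C_n_on_mult) auto
  then have "C_n_on (Suc 0) a b (?c m)" for m
    using Suc.prems assms by (intro C_n_on_coeff_fun) (auto simp: \<phi>_def elim: C_n_on_mono)
  then have c: "?c m differentiable_on {a..b}" for m
    by (simp add: C_n_on_Suc)
  have "C_n_on (Suc 0) a b (?g m)" if "m \<le> j" for m
    using Suc.prems assms that by (intro C_n_on_gen_deriv) (auto elim: C_n_on_mono)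
  then have g: "?g m differentiable_on {a..b}" if "m \<le> j" for m
    using that by (simp add: C_n_on_Suc)
  have D: "((\<lambda>y. \<Sum>m\<le>j. ?c m y * ?g m y) has_vector_derivative
      (\<Sum>m\<le>j. ?c m x * ?D (?g m) x + ?D (?c m) x * ?g m x)) (at x within {a..b})"
    using Suc.prems
    by (intro has_vector_derivative_sum has_vector_derivative_mult
        has_vector_derivative_deriv_on c g) auto
  have "nth_deriv_on a b (Suc j) h x = ?D (\<lambda>y. \<Sum>m\<le>j. ?c m y * ?g m y) x"
    unfolding nth_deriv_on_Suc using Suc by (intro deriv_on_cong) auto
  also have "\<dots> = (\<Sum>m\<le>j. ?c m x * ?D (?g m) x + ?D (?c m) x * ?g m x)"
    using \<open>a < b\<close> Suc.prems(2) D by (rule deriv_on_unique)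
  also have "\<dots> = (\<Sum>m\<le>j. \<phi> x powi ((- 1) ^ Suc m) * ?c m x * ?g (Suc m) x)
      + (\<Sum>m\<le>j. ?D (?c m) x * ?g m x)"
    by (simp only: deriv_on_gen_deriv[of f x, OF nz[OF Suc.prems(2)]] sum.distrib \<phi>_def mult_ac)
  \<comment> \<open>The second sum may be extended to \<open>Suc j\<close>, as \<open>?c (Suc j)\<close> lies above the diagonal.\<close>
  also have "(\<Sum>m\<le>j. ?D (?c m) x * ?g m x) = (\<Sum>m\<le>Suc j. ?D (?c m) x * ?g m x)"
    using \<open>a < b\<close> Suc.prems(2) by (simp add: coeff_fun_above_diagonal deriv_on_const)
  also have "(\<Sum>m\<le>j. \<phi> x powi ((- 1) ^ Suc m) * ?c m x * ?g (Suc m) x) + \<dots>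
      = ?D (?c 0) x * ?g 0 x
        + (\<Sum>m\<le>j. (?D (?c (Suc m)) x + \<phi> x powi ((- 1) ^ Suc m) * ?c m x) * ?g (Suc m) x)"
    by (simp only: sum.atMost_Suc_shift distrib_right sum.distrib add_ac)
  also have "\<dots> = (\<Sum>m\<le>Suc j. coeff_fun a b \<phi> (Suc j) m x * ?g m x)"
    unfolding sum.atMost_Suc_shift coeff_fun_Suc_0[OF \<open>a < b\<close> Suc.prems(2)]
    by (simp del: gen_deriv.simps coeff_fun.simps(1))
  finally show ?case .
qed simp

theorem theorem13:
  fixes a b :: real and n :: nat and f h \<phi> :: "real \<Rightarrow> complex"
  assumes "a < b"
    and "n \<ge> 1"
    and "C_n_on n a b f"
    and "C_n_on n a b h"
    and "\<forall>x\<in>{a..b}. f x \<noteq> 0"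
    and "\<phi> = (\<lambda>x. (f x)\<^sup>2)"
  shows "(\<forall>k<n. gen_deriv a b f k h differentiable_on {a..b}) \<and>
    (\<forall>j<n. \<forall>m. coeff_fun a b \<phi> j m differentiable_on {a..b}) \<and>
    (\<forall>x\<^sub>0\<in>{a..b}.
      (\<forall>j\<le>n. \<forall>m\<le>n. transition_mat a b \<phi> n x\<^sub>0 $$ (j, m) = coeff_fun a b \<phi> j m x\<^sub>0) \<and>
      vec (n + 1) (\<lambda>k. nth_deriv_on a b k h x\<^sub>0) =
        transition_mat a b \<phi> n x\<^sub>0 *\<^sub>v vec (n + 1) (\<lambda>k. gen_deriv a b f k h x\<^sub>0))"
proof (intro conjI ballI)
  have nz: "f x \<noteq> 0" if "x \<in> {a..b}" for x
    using assms(5) that by blast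
  then have nz': "\<phi> x \<noteq> 0" if "x \<in> {a..b}" for x
    using that by (simp add: assms(6))
  have "C_n_on n a b \<phi>"
    unfolding assms(6) power2_eq_square using assms(1,3) by (intro C_n_on_mult)
  then have "C_n_on (Suc 0) a b (coeff_fun a b \<phi> j m)" if "j < n" for j m
    using that assms(1) nz' by (intro C_n_on_coeff_fun) (auto elim: C_n_on_mono)
  then show "\<forall>j<n. \<forall>m. coeff_fun a b \<phi> j m differentiable_on {a..b}"
    by (simp add: C_n_on_Suc)
  have "C_n_on (Suc 0) a b (gen_deriv a b f k h)" if "k < n" for k
    using that assms(1,3,4) nz by (intro C_n_on_gen_deriv) (auto elim: C_n_on_mono)
  then show "\<forall>k<n. gen_deriv a b f k h differentiable_on {a..b}"
    by (simp add: C_n_on_Suc)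

  fix x assume x: "x \<in> {a..b}"
  show entries: "\<forall>j\<le>n. \<forall>m\<le>n. transition_mat a b \<phi> n x $$ (j, m) = coeff_fun a b \<phi> j m x"
    using coeff_fun_diagonal[of a b x \<phi>, OF \<open>a < b\<close> x nz'[OF x]]
    by (auto simp: transition_mat_def coeff_fun_above_diagonal)
  have row: "nth_deriv_on a b j h x
      = (\<Sum>m<n + 1. coeff_fun a b \<phi> j m x * gen_deriv a b f m h x)" if "j \<le> n" for j
  proof -
    have "nth_deriv_on a b j h x = (\<Sum>m\<le>j. coeff_fun a b \<phi> j m x * gen_deriv a b f m h x)"
      unfolding assms(6) using assms(1,3,4) nz that x by (intro nth_deriv_on_eq_sum_coeff_fun)
    \<comment> \<open>A row of the matrix has full length; the added terms lie above the diagonal.\<close>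
    also have "\<dots> = (\<Sum>m<n + 1. coeff_fun a b \<phi> j m x * gen_deriv a b f m h x)"
      using that by (intro sum.mono_neutral_left) (auto simp: coeff_fun_above_diagonal)
    finally show ?thesis .
  qed
  show "vec (n + 1) (\<lambda>k. nth_deriv_on a b k h x) =
      transition_mat a b \<phi> n x *\<^sub>v vec (n + 1) (\<lambda>k. gen_deriv a b f k h x)"
  proof (rule eq_vecI)
    have dim: "transition_mat a b \<phi> n x \<in> carrier_mat (n + 1) (n + 1)"
      by (simp add: transition_mat_def)
    then show "dim_vec (vec (n + 1) (\<lambda>k. nth_deriv_on a b k h x)) =
        dim_vec (transition_mat a b \<phi> n x *\<^sub>v vec (n + 1) (\<lambda>k. gen_deriv a b f k h x))"
      by simp
    fix j assume "j < dim_vec (transition_mat a b \<phi> n x *\<^sub>v vec (n + 1) (\<lambda>k. gen_deriv a b f k h x))"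
    with dim have j: "j < n + 1" by simp
    have "(transition_mat a b \<phi> n x *\<^sub>v vec (n + 1) (\<lambda>k. gen_deriv a b f k h x)) $ j
        = (\<Sum>m<n + 1. transition_mat a b \<phi> n x $$ (j, m) * gen_deriv a b f m h x)"
      using dim j by (auto simp: scalar_prod_def atLeast0LessThan intro!: sum.cong)
    also have "\<dots> = nth_deriv_on a b j h x"
      using entries j by (auto simp: row intro!: sum.cong)
    finally show "vec (n + 1) (\<lambda>k. nth_deriv_on a b k h x) $ j =
        (transition_mat a b \<phi> n x *\<^sub>v vec (n + 1) (\<lambda>k. gen_deriv a b f k h x)) $ j"
      using j by simp
  qed
qed

end
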